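(* For every irrational $\xi\in\mathbb{R}$, there is an $F_\sigma$ subgroup $A$ of $(\mathbb{R},+)$ satisfying $$\dim_{\mathrm H} A=0,\qquad \dim_{\mathrm H}(A\times A)=1,\qquad A+\xi A=\mathbb{R}.$$
   Context: $\dim_{\mathrm H}$ denotes Hausdorff dimension with respect to the Euclidean metric (on $\mathbb{R}$ and on $\mathbb{R}^2$). For $A\subseteq\mathbb{R}$ and $\xi\in\mathbb{R}$, $A+\xi A=\{a+\xi b: a,b\in A\}$. $F_\sigma$ means a countable union of closed subsets of $\mathbb{R}$. *)

theory Defs
  imports "HOL-Analysis.Analysis" "HOL-Algebra.Group"
begin

definition real_add_group :: "real monoid"
  where "real_add_group = \<lparr>carrier = UNIV, monoid.mult = (+), one = 0\<rparr>"

text \<open>The quantity \<open>|U|\<^sup>s\<close>, with the usual conventions \<open>|{}|\<^sup>s = 0\<close> and \<open>|U|\<^sup>0 = 1\<close> for nonempty \<open>U\<close>.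
  The case \<open>s = 0\<close> is separate because \<open>0 powr 0 = 0\<close>, which would give points no mass.
  Only meaningful for bounded \<open>U\<close>, because \<^const>\<open>diameter\<close> is real-valued.\<close>

definition diam_pow :: "real \<Rightarrow> 'a::metric_space set \<Rightarrow> ennreal"
  where "diam_pow s U = (if U = {} then 0 else if s = 0 then 1 else ennreal (diameter U powr s))"

definition hausdorff_premeasure :: "real \<Rightarrow> real \<Rightarrow> 'a::metric_space set \<Rightarrow> ennreal"
  where "hausdorff_premeasure s \<delta> E =
    (INF U \<in> {U :: nat \<Rightarrow> 'a set. E \<subseteq> (\<Union>i. U i) \<and> (\<forall>i. bounded (U i) \<and> diameter (U i) \<le> \<delta>)}.
       \<Sum>i. diam_pow s (U i))"

definition hausdorff_measure :: "real \<Rightarrow> 'a::metric_space set \<Rightarrow> ennreal"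
  where "hausdorff_measure s E = (SUP \<delta> \<in> {0<..}. hausdorff_premeasure s \<delta> E)"

definition hausdorff_dim :: "'a::metric_space set \<Rightarrow> ennreal"
  where "hausdorff_dim E = (INF s \<in> {s. 0 \<le> s \<and> hausdorff_measure s E = 0}. ennreal s)"

end

theory Submission
  imports Defs
begin

text \<open>Binary sequences \<open>\<omega>\<close> are mapped to two numbers \<open>a(\<omega>)\<close>, \<open>b(\<omega>)\<close> with \<open>a(\<omega>) + \<xi> b(\<omega>) = \<Sum>\<^sub>i \<omega>\<^sub>i / 2\<^sup>i\<^sup>+\<^sup>1\<close>, and \<open>A\<close> is
  the group generated by all of them. Then \<open>A + \<xi> A\<close> is a group containing \<open>[0, 1)\<close>, hence all of \<open>\<real>\<close>.
  Since \<open>a\<close> and \<open>b\<close> are continuous on a compact space, \<open>A\<close> is \<open>\<sigma>\<close>-compact.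

  The task is to make every element \<open>\<Sum>\<^sub>j m\<^sub>j a(\<omega>\<^sub>j) + n\<^sub>j b(\<omega>\<^sub>j)\<close> with distinct \<open>\<omega>\<^sub>j\<close> belong to a set of dimension
  zero. How the digit \<open>\<omega>\<^sub>i\<close> is shared between \<open>a\<close> and \<open>\<xi> b\<close> is free, and because \<open>\<xi>\<close> is irrational, for any integers
  \<open>(m, n)\<close> it can be shared so that \<open>m a + n b\<close> does not see that digit (\<open>comb_term_eq_0\<close>).
  The digits are grouped into blocks, each much longer than all previous digits together. On a block the
  sharing depends on an initial segment of \<open>\<omega>\<close>, so sequences with different initial segments can have
  different combinations cancelled on the same block. Finitely many distinct sequences are separated
  by initial segments, and only countably many prescriptions occur, so each finite family of
  combinations is cancelled on infinitely many common blocks. On such a block the digits before the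
  block determine the element up to an error governed by the digits after it
  (\<open>abs_comb_diff_le\<close>), that is, few sets of tiny diameter suffice
  (\<open>thinly_covered_pattern_sums\<close>). Countably many pieces of this kind exhaust \<open>A\<close> (\<open>comb_group_eq\<close>), so
  \<open>A\<close> has dimension zero.

  The same economical covers show that the product of each piece with a bounded interval has dimension
  at most one (\<open>thinly_covered_Times_interval\<close>), and these products exhaust \<open>A \<times> A\<close>. In the other
  direction, \<open>(x, y) \<mapsto> x + \<xi> y\<close> is a Lipschitz map of \<open>A \<times> A\<close> onto \<open>\<real>\<close>, so its dimension is at least one
  (\<open>one_le_hausdorff_dim_of_projection\<close>).\<close>

section \<open>Finite covers and Hausdorff dimension\<close>

definition covered_by :: "nat \<Rightarrow> real \<Rightarrow> 'a::metric_space set \<Rightarrow> bool"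
  where "covered_by N r E \<longleftrightarrow>
    (\<exists>\<U>. finite \<U> \<and> card \<U> \<le> N \<and> E \<subseteq> \<Union>\<U> \<and> (\<forall>U\<in>\<U>. bounded U \<and> diameter U \<le> r))"

text \<open>Zero \<open>s\<close>-dimensional lower Minkowski content, in terms of covers. This is stronger than a vanishing
  Hausdorff measure; since all sets of a cover share one diameter bound, a product with an interval
  can be covered by mere counting.\<close>

definition thinly_covered :: "real \<Rightarrow> 'a::metric_space set \<Rightarrow> bool"
  where "thinly_covered s E \<longleftrightarrow>
    (\<forall>e>0. \<exists>N r. 0 < r \<and> r \<le> e \<and> real N * r powr s \<le> e \<and> covered_by N r E)"

lemma bounded_diameter_leI:
  assumes "\<And>x y. x \<in> U \<Longrightarrow> y \<in> U \<Longrightarrow> dist x y \<le> r" and "0 \<le> r"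
  shows "bounded U \<and> diameter U \<le> r"
proof
  show "bounded U"
    using assms(1) unfolding bounded_two_points by blast
  show "diameter U \<le> r"
  proof (cases "U = {}")
    case False
    then show ?thesis
      unfolding diameter_def using assms(1) by (auto intro!: cSUP_least)
  qed (use assms(2) in simp)
qed

lemma covered_by_imageI:
  assumes "finite I" "card I \<le> N" "E \<subseteq> (\<Union>i\<in>I. U i)" "0 \<le> r"
    and "\<And>i x y. i \<in> I \<Longrightarrow> x \<in> U i \<Longrightarrow> y \<in> U i \<Longrightarrow> dist x y \<le> r"
  shows "covered_by N r E"
  unfolding covered_by_def
proof (intro exI[of _ "U ` I"] conjI ballI)
  show "card (U ` I) \<le> N"
    using card_image_le[OF assms(1)] assms(2) order_trans by blast
qed (use assms bounded_diameter_leI[OF assms(5,4)] in auto)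

lemma diam_pow_pos: "s \<noteq> 0 \<Longrightarrow> diam_pow s U = ennreal (diameter U powr s)"
  by (simp add: diam_pow_def)

lemma thinly_covered_cover_sequence:
  fixes E :: "'a::metric_space set"
  assumes "thinly_covered s E" "0 < s" "0 < e" "0 < \<delta>"
  obtains U :: "nat \<Rightarrow> 'a set" where "E \<subseteq> (\<Union>i. U i)"
    "\<And>i. bounded (U i) \<and> diameter (U i) \<le> \<delta>" "(\<Sum>i. diam_pow s (U i)) \<le> ennreal e"
proof -
  obtain N r where Nr: "0 < r" "r \<le> min e \<delta>" "real N * r powr s \<le> min e \<delta>" "covered_by N r E"
    using assms(1)[unfolded thinly_covered_def, rule_format, of "min e \<delta>"] assms(3,4) by auto
  then obtain \<U> where \<U>: "finite \<U>" "card \<U> \<le> N" "E \<subseteq> \<Union>\<U>" "\<forall>U\<in>\<U>. bounded U \<and> diameter U \<le> r"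
    unfolding covered_by_def by blast
  obtain f where f: "bij_betw f {..<card \<U>} \<U>"
    using ex_bij_betw_nat_finite[OF \<U>(1)] unfolding atLeast0LessThan by blast
  define U where "U = (\<lambda>i. if i < card \<U> then f i else {})"
  show thesis
  proof
    show "E \<subseteq> (\<Union>i. U i)"
    proof
      fix x assume "x \<in> E"
      then obtain V where "V \<in> \<U>" "x \<in> V" using \<U>(3) by blast
      moreover have "V \<in> f ` {..<card \<U>}" using \<open>V \<in> \<U>\<close> bij_betw_imp_surj_on[OF f] by simp
      ultimately show "x \<in> (\<Union>i. U i)" by (auto simp: U_def)
    qed
    have fm: "f i \<in> \<U>" if "i < card \<U>" for i
      using bij_betwE[OF f] that by simp
    show "bounded (U i) \<and> diameter (U i) \<le> \<delta>" for i
    proof (cases "i < card \<U>")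
      case True
      then have "bounded (f i)" "diameter (f i) \<le> r" using fm \<U>(4) by auto
      then show ?thesis using True Nr(2) by (simp add: U_def)
    qed (use assms(4) in \<open>simp add: U_def\<close>)
    have "(\<Sum>i. diam_pow s (U i)) = (\<Sum>i<card \<U>. diam_pow s (U i))"
      by (rule suminf_finite) (auto simp: U_def diam_pow_def)
    also have "\<dots> \<le> (\<Sum>i<card \<U>. ennreal (r powr s))"
    proof (rule sum_mono)
      fix i assume "i \<in> {..<card \<U>}"
      then have "bounded (U i)" "diameter (U i) \<le> r"
        using fm[of i] \<U>(4) by (auto simp: U_def)
      then show "diam_pow s (U i) \<le> ennreal (r powr s)"
        using assms(2) by (auto simp: diam_pow_pos intro!: ennreal_leI powr_mono2 diameter_ge_0)
    qed
    also have "\<dots> = ennreal (real (card \<U>) * r powr s)"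
      by (simp add: ennreal_mult' ennreal_of_nat_eq_real_of_nat)
    also have "\<dots> \<le> ennreal e"
    proof (rule ennreal_leI)
      have "real (card \<U>) * r powr s \<le> real N * r powr s"
        using \<U>(2) by (intro mult_right_mono) auto
      then show "real (card \<U>) * r powr s \<le> e" using Nr(3) by linarith
    qed
    finally show "(\<Sum>i. diam_pow s (U i)) \<le> ennreal e" .
  qed
qed

text \<open>Countable subadditivity on null sets: the \<open>j\<close>-th piece receives a cover of total mass at most
  \<open>e / 2\<^sup>j\<^sup>+\<^sup>1\<close>, and the covers are merged into one sequence by the pairing function.\<close>

lemma hausdorff_measure_countable_Un_thinly_covered:
  fixes E :: "'i \<Rightarrow> 'a::metric_space set"
  assumes "countable I" "\<And>i. i \<in> I \<Longrightarrow> thinly_covered s (E i)" "0 < s" "X \<subseteq> (\<Union>i\<in>I. E i)"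
  shows "hausdorff_measure s X = 0"
proof -
  have "hausdorff_premeasure s \<delta> X = 0" if \<delta>: "0 < \<delta>" for \<delta>
  proof (cases "I = {}")
    case True
    then have "X = {}" using assms(4) by simp
    have "hausdorff_premeasure s \<delta> X \<le> (\<Sum>i. diam_pow s ({}::'a set))"
      unfolding hausdorff_premeasure_def
      by (rule INF_lower2[of "\<lambda>_. {}"]) (use \<open>X = {}\<close> \<delta> in auto)
    then show ?thesis by (simp add: diam_pow_def)
  next
    case False
    have "hausdorff_premeasure s \<delta> X \<le> 0 + ennreal e" if e: "0 < e" for e
    proof -
      define F where "F = (\<lambda>j. E (from_nat_into I j))"
      have thin: "thinly_covered s (F j)" for j
        unfolding F_def by (rule assms(2)[OF from_nat_into[OF False]])
      define P where "P = (\<lambda>j U. F j \<subseteq> (\<Union>i. U i) \<and> (\<forall>i. bounded (U i) \<and> diameter (U i) \<le> \<delta>) \<and>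
          (\<Sum>i. diam_pow s (U i)) \<le> ennreal (e * (1/2) ^ Suc j))"
      have "\<forall>j. \<exists>U. P j U"
      proof
        fix j
        have "0 < e * (1/2) ^ Suc j" using e by simp
        then obtain U where "F j \<subseteq> (\<Union>i. U i)" "\<And>i. bounded (U i) \<and> diameter (U i) \<le> \<delta>"
            "(\<Sum>i. diam_pow s (U i)) \<le> ennreal (e * (1/2) ^ Suc j)"
          using thinly_covered_cover_sequence[OF thin[of j] assms(3) _ \<delta>] by blast
        then have "P j U" by (simp add: P_def)
        then show "\<exists>U. P j U" by blast
      qed
      then obtain U where "\<forall>j. P j (U j)" using choice[of P] by blast
      then have U: "F j \<subseteq> (\<Union>i. U j i)" "bounded (U j i)" "diameter (U j i) \<le> \<delta>"
        "(\<Sum>i. diam_pow s (U j i)) \<le> ennreal (e * (1/2) ^ Suc j)" for i j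
        by (simp_all add: P_def)
      define V where "V = (\<lambda>n. case_prod U (prod_decode n))"
      have V: "bounded (V n) \<and> diameter (V n) \<le> \<delta>" for n
        using U(2,3) by (simp add: V_def case_prod_beta)
      have "X \<subseteq> (\<Union>n. V n)"
      proof
        fix x assume "x \<in> X"
        then obtain i where "i \<in> I" "x \<in> E i" using assms(4) by blast
        moreover obtain j where "from_nat_into I j = i"
          using from_nat_into_surj[OF assms(1) \<open>i \<in> I\<close>] by blast
        ultimately have "x \<in> F j" by (simp add: F_def)
        then obtain i where "x \<in> U j i" using U(1) by blast
        then have "x \<in> V (prod_encode (j, i))" by (simp add: V_def)
        then show "x \<in> (\<Union>n. V n)" by blast
      qed
      then have "hausdorff_premeasure s \<delta> X \<le> (\<Sum>n. diam_pow s (V n))"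
        unfolding hausdorff_premeasure_def
        using V by (intro INF_lower) simp
      also have "\<dots> = (\<Sum>j. \<Sum>i. diam_pow s (U j i))"
        using suminf_ennreal_2dimen[of "\<lambda>j. \<Sum>i. diam_pow s (U j i)" "\<lambda>p. diam_pow s (case_prod U p)"]
        by (simp add: V_def)
      also have "\<dots> \<le> (\<Sum>j. ennreal (e * (1/2) ^ Suc j))"
        by (intro suminf_le U) auto
      also have "\<dots> = ennreal (e * 1)"
        using sums_mult[OF power_half_series, of e] e by (intro suminf_ennreal_eq) auto
      finally show ?thesis by simp
    qed
    then have "hausdorff_premeasure s \<delta> X \<le> 0"
      by (rule ennreal_le_epsilon)
    then show ?thesis by simp
  qed
  then have "hausdorff_measure s X = (SUP \<delta>\<in>{0::real<..}. 0)"
    unfolding hausdorff_measure_def by (intro SUP_cong) auto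
  then show ?thesis by simp
qed

lemma hausdorff_dim_leI:
  assumes "0 \<le> t" "\<And>s. s > t \<Longrightarrow> hausdorff_measure s E = 0"
  shows "hausdorff_dim E \<le> ennreal t"
proof (rule ennreal_le_epsilon)
  fix e :: real assume "0 < e"
  then have "hausdorff_dim E \<le> ennreal (t + e)"
    unfolding hausdorff_dim_def using assms by (intro INF_lower) auto
  then show "hausdorff_dim E \<le> ennreal t + ennreal e"
    using assms(1) \<open>0 < e\<close> by simp
qed

text \<open>A box \<open>U \<times> J\<close> with \<open>U\<close> and \<open>J\<close> of size \<open>r\<close> costs \<open>r\<^sup>1\<^sup>+\<^sup>t\<close>, and about \<open>M / r\<close> intervals \<open>J\<close> are used over each \<open>U\<close>;
  so the extra factor raises the exponent by exactly one.\<close>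

lemma thinly_covered_Times_interval:
  fixes E :: "real set" and M :: real
  assumes "thinly_covered t E" "0 < t" "0 \<le> M"
  shows "thinly_covered (1 + t) (E \<times> {-M..M})"
  unfolding thinly_covered_def
proof (intro allI impI)
  fix e :: real assume e: "0 < e"
  define c where "c = (2 * M + 2) * 2 powr (1 + t)"
  have c: "0 < c" using assms(3) unfolding c_def by simp
  define e' where "e' = min (min (e / 2) 1) (e / c)"
  have "0 < e'" using e c by (simp add: e'_def)
  then obtain N r where Nr: "0 < r" "r \<le> e'" "real N * r powr t \<le> e'" "covered_by N r E"
    using assms(1) unfolding thinly_covered_def by blast
  then obtain \<U> where \<U>: "finite \<U>" "card \<U> \<le> N" "E \<subseteq> \<Union>\<U>" "\<forall>U\<in>\<U>. bounded U \<and> diameter U \<le> r"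
    unfolding covered_by_def by blast
  define K where "K = Suc (nat \<lfloor>2 * M / r\<rfloor>)"
  have r1: "r \<le> 1" "2 * r \<le> e" "r \<le> e / c" using Nr(2) by (auto simp: e'_def)
  have K: "real K * r \<le> 2 * M + 2"
  proof -
    have "real K \<le> 2 * M / r + 1"
      using assms(3) Nr(1) by (simp add: K_def)
    then have "real K * r \<le> (2 * M / r + 1) * r" using Nr(1) by (intro mult_right_mono) auto
    also have "\<dots> = 2 * M + r" using Nr(1) by (simp add: field_simps)
    finally show ?thesis using r1 by linarith
  qed
  have "covered_by (N * K) (2 * r) (E \<times> {-M..M})"
  proof (rule covered_by_imageI[where I = "\<U> \<times> {..<K}"
        and U = "\<lambda>(U, j). U \<times> {-M + real j * r..-M + real (Suc j) * r}"])
    show "card (\<U> \<times> {..<K}) \<le> N * K" using \<U>(2) by (simp add: card_cartesian_product)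
    show "E \<times> {-M..M} \<subseteq> (\<Union>i\<in>\<U> \<times> {..<K}. case i of (U, j) \<Rightarrow> U \<times> {-M + real j * r..-M + real (Suc j) * r})"
    proof
      fix p assume "p \<in> E \<times> {-M..M}"
      then obtain x y where p: "p = (x, y)" and x: "x \<in> E" and y: "- M \<le> y" "y \<le> M" by auto
      from x obtain U where U: "U \<in> \<U>" "x \<in> U" using \<U>(3) by blast
      define z where "z = (y + M) / r"
      have z: "0 \<le> z" "z \<le> 2 * M / r" using y Nr(1) by (auto simp: z_def divide_right_mono)
      have yz: "y = - M + z * r" using Nr(1) by (simp add: z_def)
      define j where "j = nat \<lfloor>z\<rfloor>"
      have j: "real j \<le> z" "z \<le> 1 + real j" using z(1) unfolding j_def by linarith+
      have "\<lfloor>z\<rfloor> \<le> \<lfloor>2 * M / r\<rfloor>" using z(2) by (rule floor_mono)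
      then have "j < K" using z(1) by (simp add: j_def K_def)
      moreover have "real j * r \<le> z * r" "z * r \<le> (1 + real j) * r"
        using j Nr(1) by (auto intro!: mult_right_mono)
      ultimately show "p \<in> (\<Union>i\<in>\<U> \<times> {..<K}. case i of (U, j) \<Rightarrow> U \<times> {-M + real j * r..-M + real (Suc j) * r})"
        using U yz by (intro UN_I[of "(U, j)"]) (auto simp: p)
    qed
    show "dist x y \<le> 2 * r" if h: "i \<in> \<U> \<times> {..<K}"
      "x \<in> (case i of (U, j) \<Rightarrow> U \<times> {-M + real j * r..-M + real (Suc j) * r})"
      "y \<in> (case i of (U, j) \<Rightarrow> U \<times> {-M + real j * r..-M + real (Suc j) * r})" for i x y
    proof -
      obtain U j where i: "i = (U, j)" "U \<in> \<U>" using h by blast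
      have "fst x \<in> U" "fst y \<in> U" using h(2,3) i by auto
      then have "dist (fst x) (fst y) \<le> r"
        using \<U>(4) i(2) diameter_bounded_bound[of U "fst x" "fst y"] by force
      moreover have "dist (snd x) (snd y) \<le> r"
        using h(2,3) unfolding i by (auto simp: dist_real_def algebra_simps)
      moreover have "dist x y \<le> dist (fst x) (fst y) + dist (snd x) (snd y)"
        unfolding dist_prod_def by (rule sqrt_sum_squares_le_sum) auto
      ultimately show ?thesis by linarith
    qed
  qed (use \<U> Nr in auto)
  moreover have "real (N * K) * (2 * r) powr (1 + t) \<le> e"
  proof -
    have "real (N * K) * (2 * r) powr (1 + t) = (real N * r powr t) * (real K * r) * 2 powr (1 + t)"
      using Nr(1) by (simp add: powr_mult powr_add)
    also have "\<dots> \<le> (e / c) * (2 * M + 2) * 2 powr (1 + t)"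
      using Nr(1,3) K e c by (intro mult_right_mono mult_mono) (auto simp: e'_def)
    also have "\<dots> = e" using assms(3) by (simp add: c_def)
    finally show ?thesis .
  qed
  ultimately show "\<exists>N r. 0 < r \<and> r \<le> e \<and> real N * r powr (1 + t) \<le> e \<and> covered_by N r (E \<times> {-M..M})"
    using Nr(1) r1 by (intro exI[of _ "N * K"] exI[of _ "2 * r"]) auto
qed

text \<open>The projection is Lipschitz, so a cover of \<open>E\<close> with small sum of diameters would give a cover of the
  unit interval of Lebesgue measure less than one. Exponents \<open>s < 1\<close> only increase the sum as soon as
  the diameters are at most one.\<close>

lemma one_le_hausdorff_dim_of_projection:
  fixes E :: "(real \<times> real) set" and \<xi> :: real
  assumes "{0..1} \<subseteq> (\<lambda>(x, y). x + \<xi> * y) ` E"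
  shows "1 \<le> hausdorff_dim E"
proof -
  define L where "L = 1 + \<bar>\<xi>\<bar>"
  have L: "0 < L" by (simp add: L_def)
  have "1 \<le> ennreal s" if s: "0 \<le> s" "hausdorff_measure s E = 0" for s
  proof (rule ccontr)
    assume "\<not> 1 \<le> ennreal s"
    then have s1: "s < 1" by (simp add: ennreal_ge_1 not_le)
    have "hausdorff_premeasure s 1 E \<le> hausdorff_measure s E"
      unfolding hausdorff_measure_def by (rule SUP_upper) auto
    then have "hausdorff_premeasure s 1 E = 0" using s(2) by simp
    moreover have "ennreal (1 / (2 * L)) \<le> hausdorff_premeasure s 1 E"
      unfolding hausdorff_premeasure_def
    proof (rule INF_greatest, clarsimp)
      fix U :: "nat \<Rightarrow> (real \<times> real) set"
      assume U: "E \<subseteq> (\<Union>i. U i)" and bd: "\<forall>i. bounded (U i) \<and> diameter (U i) \<le> 1"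
      define \<phi> where "\<phi> = (\<lambda>(x::real, y::real). x + \<xi> * y)"
      have lip: "\<bar>\<phi> p - \<phi> q\<bar> \<le> L * dist p q" for p q
      proof -
        obtain x y x' y' where pq: "p = (x, y)" "q = (x', y')" by (meson surj_pair)
        have "\<bar>\<phi> p - \<phi> q\<bar> = \<bar>(x - x') + \<xi> * (y - y')\<bar>" by (simp add: \<phi>_def pq algebra_simps)
        also have "\<dots> \<le> \<bar>x - x'\<bar> + \<bar>\<xi>\<bar> * \<bar>y - y'\<bar>"
          using abs_triangle_ineq[of "x - x'" "\<xi> * (y - y')"] by (simp add: abs_mult)
        also have "\<dots> \<le> dist p q + \<bar>\<xi>\<bar> * dist p q"
          using dist_fst_le[of p q] dist_snd_le[of p q]
          by (intro add_mono mult_left_mono) (auto simp: pq dist_real_def)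
        finally show ?thesis by (simp add: L_def algebra_simps)
      qed
      define J where "J = (\<lambda>i. if U i = {} then {} else
         cball (\<phi> (SOME p. p \<in> U i)) (L * diameter (U i)))"
      have "{0..1} \<subseteq> (\<Union>i. J i)"
      proof
        fix z :: real assume "z \<in> {0..1}"
        then have "z \<in> \<phi> ` E" using assms unfolding \<phi>_def by (rule subsetD[rotated])
        then obtain p where p: "p \<in> E" "z = \<phi> p" by blast
        then obtain i where i: "p \<in> U i" using U by blast
        let ?q = "SOME p. p \<in> U i"
        have q: "?q \<in> U i" using i by (rule someI)
        have "dist ?q p \<le> diameter (U i)" using bd q i diameter_bounded_bound by blast
        then have "L * dist ?q p \<le> L * diameter (U i)" using L by simp
        then have "z \<in> J i" using lip[of ?q p] i p(2) by (auto simp: J_def dist_real_def)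
        then show "z \<in> (\<Union>i. J i)" by blast
      qed
      then have "emeasure lborel {0..1::real} \<le> emeasure lborel (\<Union>i. J i)"
        by (intro emeasure_mono) (auto simp: J_def)
      also have "\<dots> \<le> (\<Sum>i. emeasure lborel (J i))"
        by (intro emeasure_subadditive_countably) (auto simp: J_def)
      also have "\<dots> \<le> (\<Sum>i. ennreal (2 * L) * diam_pow s (U i))"
      proof (intro suminf_le)
        fix i
        show "emeasure lborel (J i) \<le> ennreal (2 * L) * diam_pow s (U i)"
        proof (cases "U i = {}")
          case False
          have d: "0 \<le> diameter (U i)" "diameter (U i) \<le> 1" using bd diameter_ge_0 by auto
          have le: "ennreal (diameter (U i)) \<le> diam_pow s (U i)"
          proof (cases "s = 0 \<or> diameter (U i) = 0")
            case True then show ?thesis using False d by (auto simp: diam_pow_def)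
          next
            case False
            then have "diameter (U i) powr 1 \<le> diameter (U i) powr s"
              using d s1 by (intro powr_mono') auto
            then show ?thesis using False d by (auto simp: diam_pow_pos intro!: ennreal_leI)
          qed
          have "emeasure lborel (J i) = ennreal (2 * L) * ennreal (diameter (U i))"
            using False d L by (simp add: J_def cball_eq_atLeastAtMost ennreal_mult'[symmetric])
          also have "\<dots> \<le> ennreal (2 * L) * diam_pow s (U i)"
            by (rule mult_left_mono[OF le]) auto
          finally show ?thesis .
        qed (simp add: J_def)
      qed auto
      also have "\<dots> = ennreal (2 * L) * (\<Sum>i. diam_pow s (U i))" by simp
      finally have 1: "1 \<le> ennreal (2 * L) * (\<Sum>i. diam_pow s (U i))" by simp
      have "ennreal (1 / (2 * L)) = ennreal (1 / (2 * L)) * 1" by simp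
      also have "\<dots> \<le> ennreal (1 / (2 * L)) * (ennreal (2 * L) * (\<Sum>i. diam_pow s (U i)))"
        using 1 by (rule mult_left_mono) auto
      also have "\<dots> = (\<Sum>i. diam_pow s (U i))"
        using L by (simp add: mult.assoc[symmetric] ennreal_mult'[symmetric])
      finally show "ennreal (1 / (2 * L)) \<le> (\<Sum>i. diam_pow s (U i))" .
    qed
    ultimately show False using L by (simp add: ennreal_eq_0_iff)
  qed
  then show ?thesis
    unfolding hausdorff_dim_def by (intro INF_greatest) auto
qed

section \<open>Binary sequences\<close>

definition initial :: "nat \<Rightarrow> (nat \<Rightarrow> bool) \<Rightarrow> bool list"
  where "initial k \<omega> = map \<omega> [0..<k]"

lemma initial_eq_iff: "initial k \<omega> = initial k \<omega>' \<longleftrightarrow> (\<forall>i<k. \<omega> i = \<omega>' i)"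
  by (auto simp: initial_def)

lemma length_initial [simp]: "length (initial k \<omega>) = k"
  by (simp add: initial_def)

lemma nth_initial: "i < k \<Longrightarrow> initial k \<omega> ! i = \<omega> i"
  by (simp add: initial_def)

lemma take_initial: "k \<le> i \<Longrightarrow> take k (initial i \<omega>) = initial k \<omega>"
  by (simp add: initial_def take_map)

lemma initial_eq_mono: "initial k \<omega> = initial k \<omega>' \<Longrightarrow> i \<le> k \<Longrightarrow> initial i \<omega> = initial i \<omega>'"
  by (simp add: initial_eq_iff)

lemma open_cylinder: "open {\<omega>. initial k \<omega> = w}"
proof (cases "\<exists>\<omega>0. initial k \<omega>0 = w")
  case True
  then obtain \<omega>0 where w: "initial k \<omega>0 = w" by blast
  have "{\<omega>. initial k \<omega> = w} = (\<Inter>i\<in>{..<k}. (\<lambda>\<omega>. \<omega> i) -` {\<omega>0 i})"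
    by (auto simp: w[symmetric] initial_eq_iff)
  also have "open \<dots>"
    by (intro open_INT ballI open_vimage open_discrete continuous_on_product_coordinates) auto
  finally show ?thesis .
next
  case False
  then have "{\<omega>. initial k \<omega> = w} = {}" by blast
  then show ?thesis by simp
qed

text \<open>The product topology on binary sequences makes every function of finitely many digits continuous.\<close>

lemma continuous_on_initial:
  fixes g :: "bool list \<Rightarrow> 'a::topological_space"
  shows "continuous_on UNIV (\<lambda>\<omega>. g (initial k \<omega>))"
  unfolding continuous_on_open_vimage[OF open_UNIV]
proof (intro allI impI)
  fix B :: "'a set"
  have "(\<lambda>\<omega>. g (initial k \<omega>)) -` B \<inter> UNIV = (\<Union>w\<in>{w. g w \<in> B}. {\<omega>. initial k \<omega> = w})"
    by auto
  also have "open \<dots>" by (intro open_UN ballI open_cylinder)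
  finally show "open ((\<lambda>\<omega>. g (initial k \<omega>)) -` B \<inter> UNIV)" .
qed

lemma compact_cylinder: "compact {\<omega>. initial k \<omega> = w}"
proof -
  have "compact_space (product_topology (\<lambda>i::nat. euclidean :: bool topology) UNIV)"
    unfolding compact_space_product_topology
    by (simp add: compact_space_def finite_imp_compact)
  then have "compact (UNIV :: (nat \<Rightarrow> bool) set)"
    unfolding euclidean_product_topology compact_space_def by simp
  moreover have "closed {\<omega>. initial k \<omega> = w}"
  proof -
    have "- {\<omega>. initial k \<omega> = w} = (\<Union>w'\<in>-{w}. {\<omega>. initial k \<omega> = w'})" by auto
    also have "open \<dots>" by (intro open_UN ballI open_cylinder)
    finally show ?thesis by (simp add: closed_def)
  qed
  ultimately show ?thesis
    using compact_Int_closed[of UNIV] by simp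
qed

lemma initial_separates:
  assumes "finite S"
  shows "\<exists>k. inj_on (initial k) S"
  using assms
proof (induction S)
  case empty
  then show ?case by simp
next
  case (insert \<omega> S)
  then obtain k where k: "inj_on (initial k) S" by blast
  have "\<forall>\<omega>'\<in>S. \<exists>i. \<omega>' i \<noteq> \<omega> i"
  proof
    fix \<omega>' assume "\<omega>' \<in> S"
    then have "\<omega>' \<noteq> \<omega>" using insert.hyps(2) by auto
    then show "\<exists>i. \<omega>' i \<noteq> \<omega> i" unfolding fun_eq_iff by simp
  qed
  then obtain j where j: "\<omega>' (j \<omega>') \<noteq> \<omega> (j \<omega>')" if "\<omega>' \<in> S" for \<omega>' by metis
  define K where "K = k + (\<Sum>\<omega>'\<in>S. Suc (j \<omega>'))"
  have jK: "j \<omega>' < K" if "\<omega>' \<in> S" for \<omega>'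
    using member_le_sum[of \<omega>' S "\<lambda>\<omega>'. Suc (j \<omega>')"] that insert.hyps(1) by (simp add: K_def)
  have "inj_on (initial K) (insert \<omega> S)"
  proof (rule inj_onI)
    fix x y assume xy: "x \<in> insert \<omega> S" "y \<in> insert \<omega> S" "initial K x = initial K y"
    show "x = y"
    proof (cases "x \<in> S \<and> y \<in> S")
      case True
      have "initial k x = initial k y" using xy(3) by (rule initial_eq_mono) (simp add: K_def)
      then show ?thesis using k True by (auto dest: inj_onD)
    next
      case False
      show ?thesis
        using False xy(1,2) xy(3)[unfolded initial_eq_iff] j[of x] j[of y] jK[of x] jK[of y]
        by (cases "x = \<omega>"; cases "y = \<omega>") force+
    qed
  qed
  then show ?case by blast
qed

definition binary_value :: "(nat \<Rightarrow> bool) \<Rightarrow> real"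
  where "binary_value \<omega> = (\<Sum>i. of_bool (\<omega> i) / 2 ^ Suc i)"

text \<open>The digits are the parities of \<open>\<lfloor>2\<^sup>i\<^sup>+\<^sup>1 t\<rfloor>\<close>, whose partial sums are the dyadic truncations of \<open>t\<close>.\<close>

lemma ex_binary_value_eq:
  fixes t :: real
  assumes "0 \<le> t" "t < 1"
  shows "\<exists>\<omega>. binary_value \<omega> = t"
proof
  define \<omega> where "\<omega> = (\<lambda>i. odd \<lfloor>t * 2 ^ Suc i\<rfloor>)"
  have step: "real_of_int \<lfloor>2 * x\<rfloor> = 2 * \<lfloor>x\<rfloor> + of_bool (odd \<lfloor>2 * x\<rfloor>)" for x :: real
  proof -
    have "\<lfloor>2 * x\<rfloor> = 2 * \<lfloor>x\<rfloor> \<or> \<lfloor>2 * x\<rfloor> = 2 * \<lfloor>x\<rfloor> + 1" by linarith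
    then show ?thesis by auto
  qed
  have partial: "(\<Sum>i<n. of_bool (\<omega> i) / 2 ^ Suc i) = \<lfloor>t * 2 ^ n\<rfloor> / 2 ^ n" for n
  proof (induction n)
    case 0
    have "\<lfloor>t\<rfloor> = 0" using assms by linarith
    then show ?case by simp
  next
    case (Suc n)
    have "real_of_int \<lfloor>t * 2 ^ Suc n\<rfloor> = 2 * \<lfloor>t * 2 ^ n\<rfloor> + of_bool (\<omega> n)"
      using step[of "t * 2 ^ n"] by (simp add: \<omega>_def mult.left_commute)
    then show ?case using Suc by (simp add: field_simps)
  qed
  have "(\<lambda>i. of_bool (\<omega> i) / 2 ^ Suc i) sums t"
    unfolding sums_def partial
  proof (rule tendsto_sandwich)
    show "(\<lambda>n. t - (1/2) ^ n) \<longlonglongrightarrow> t"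
      by (auto intro!: tendsto_eq_intros LIMSEQ_power_zero)
    show "\<forall>\<^sub>F n in sequentially. t - (1/2) ^ n \<le> \<lfloor>t * 2 ^ n\<rfloor> / 2 ^ n"
    proof (intro always_eventually allI)
      fix n
      have "t * 2 ^ n - 1 \<le> \<lfloor>t * 2 ^ n\<rfloor>" by linarith
      then have "(t * 2 ^ n - 1) / 2 ^ n \<le> \<lfloor>t * 2 ^ n\<rfloor> / 2 ^ n"
        by (rule divide_right_mono) simp
      then show "t - (1/2) ^ n \<le> \<lfloor>t * 2 ^ n\<rfloor> / 2 ^ n"
        by (simp add: diff_divide_distrib power_one_over)
    qed
    show "\<forall>\<^sub>F n in sequentially. \<lfloor>t * 2 ^ n\<rfloor> / 2 ^ n \<le> t"
    proof (intro always_eventually allI)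
      fix n
      have "\<lfloor>t * 2 ^ n\<rfloor> / 2 ^ n \<le> (t * 2 ^ n) / 2 ^ n" by (rule divide_right_mono) auto
      then show "\<lfloor>t * 2 ^ n\<rfloor> / 2 ^ n \<le> t" by simp
    qed
  qed simp
  then show "binary_value \<omega> = t" by (simp add: binary_value_def sums_iff)
qed

section \<open>The two generating functions\<close>

text \<open>A pattern \<open>(k, xs)\<close> prescribes, for the sequences whose first \<open>k\<close> digits form a key of \<open>xs\<close>, the integer
  combination \<open>m a + n b\<close> that has to vanish on a block of digits. There are only countably many patterns,
  so each can be given infinitely many blocks.\<close>

type_synonym pattern = "nat \<times> (bool list \<times> int \<times> int) list"

text \<open>Block \<open>n\<close> consists of the digit positions from \<open>n!\<close> up to \<open>(n+1)! - 1\<close>, and position 0 is put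
  into the otherwise empty block 0. What matters is that the end of a
  block is \<open>n + 1\<close> times its beginning, a ratio that tends to infinity.\<close>

definition block :: "nat \<Rightarrow> nat"
  where "block i = (LEAST n. i < fact (Suc n))"

definition pattern_of_block :: "nat \<Rightarrow> pattern"
  where "pattern_of_block n = from_nat (fst (prod_decode n))"

text \<open>A digit that contributes \<open>\<beta>\<close> to \<open>b\<close> contributes \<open>1 - \<xi> \<beta>\<close> to \<open>a\<close>, hence \<open>m - (m \<xi> - n) \<beta>\<close> to \<open>m a + n b\<close>; the
  value below is the \<open>\<beta>\<close> for which this is zero. It is suppressed while it exceeds \<open>(3/2)\<^sup>i\<close>, which keeps the
  series for \<open>b\<close> dominated by \<open>(3/4)\<^sup>i\<close> and affects only finitely many blocks of a given pattern.
  The word \<open>w\<close> is meant to hold the \<open>i\<close> digits before position \<open>i\<close>.\<close>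

definition coefficient :: "real \<Rightarrow> nat \<Rightarrow> bool list \<Rightarrow> real"
  where "coefficient \<xi> i w =
    (case pattern_of_block (block i) of (k, xs) \<Rightarrow>
      (case map_of xs (take k w) of
        None \<Rightarrow> 0
      | Some (m, n) \<Rightarrow>
          (let t = real_of_int m / (real_of_int m * \<xi> - real_of_int n) in if \<bar>t\<bar> \<le> (3/2) ^ i then t else 0)))"

definition gen_b :: "real \<Rightarrow> (nat \<Rightarrow> bool) \<Rightarrow> real"
  where "gen_b \<xi> \<omega> = (\<Sum>i. coefficient \<xi> i (initial i \<omega>) * (of_bool (\<omega> i) / 2 ^ Suc i))"

text \<open>The identity \<open>a + \<xi> b = binary_value\<close>, which makes the sum set large, is built into the definition.\<close>

definition gen_a :: "real \<Rightarrow> (nat \<Rightarrow> bool) \<Rightarrow> real"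
  where "gen_a \<xi> \<omega> = binary_value \<omega> - \<xi> * gen_b \<xi> \<omega>"

definition comb :: "real \<Rightarrow> int \<Rightarrow> int \<Rightarrow> (nat \<Rightarrow> bool) \<Rightarrow> real"
  where "comb \<xi> m n \<omega> = of_int m * gen_a \<xi> \<omega> + of_int n * gen_b \<xi> \<omega>"

definition comb_term :: "real \<Rightarrow> int \<Rightarrow> int \<Rightarrow> nat \<Rightarrow> (nat \<Rightarrow> bool) \<Rightarrow> real"
  where "comb_term \<xi> m n i \<omega> =
    (of_int m - (of_int m * \<xi> - of_int n) * coefficient \<xi> i (initial i \<omega>)) * (of_bool (\<omega> i) / 2 ^ Suc i)"

definition comb_size :: "real \<Rightarrow> int \<Rightarrow> int \<Rightarrow> real"
  where "comb_size \<xi> m n = \<bar>real_of_int m\<bar> + \<bar>of_int m * \<xi> - of_int n\<bar>"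

lemma comb_size_nonneg: "0 \<le> comb_size \<xi> m n"
  by (simp add: comb_size_def)

lemma block_eq:
  assumes "fact n \<le> i" "i < fact (Suc n)"
  shows "block i = n"
  unfolding block_def
proof (rule Least_equality)
  show "i < fact (Suc n)" by fact
next
  fix y assume y: "i < fact (Suc y)"
  show "n \<le> y"
  proof (rule ccontr)
    assume "\<not> n \<le> y"
    then have "(fact (Suc y) :: nat) \<le> fact n" by (intro fact_mono_nat) simp
    then show False using y assms(1) by linarith
  qed
qed

text \<open>Block numbers encode pairs, and only the first component determines the pattern; the second
  component makes the block number as large as desired.\<close>

lemma pattern_recurs: "\<exists>n\<ge>n0. pattern_of_block n = p"
  by (rule exI[of _ "prod_encode (to_nat p, n0)"])
    (simp add: pattern_of_block_def le_prod_encode_2)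

lemma abs_coefficient_le: "\<bar>coefficient \<xi> i w\<bar> \<le> (3/2) ^ i"
  by (auto simp: coefficient_def Let_def split: prod.split option.split)

lemma abs_coefficient_digit_le: "\<bar>coefficient \<xi> i w * (of_bool c / 2 ^ Suc i)\<bar> \<le> (3/4) ^ i"
proof -
  have "\<bar>coefficient \<xi> i w * (of_bool c / 2 ^ Suc i)\<bar> \<le> (3/2) ^ i * (1 / 2 ^ i)"
    unfolding abs_mult by (intro mult_mono abs_coefficient_le) (auto simp: field_simps)
  also have "\<dots> = (3/4) ^ i"
    by (simp add: power_divide flip: power_mult_distrib)
  finally show ?thesis .
qed

lemma abs_comb_term_le: "\<bar>comb_term \<xi> m n i \<omega>\<bar> \<le> comb_size \<xi> m n * (3/4) ^ i"
proof -
  let ?c = "coefficient \<xi> i (initial i \<omega>)" and ?e = "of_bool (\<omega> i) / 2 ^ Suc i :: real"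
  have "comb_term \<xi> m n i \<omega> = of_int m * ?e - (of_int m * \<xi> - of_int n) * (?c * ?e)"
    unfolding comb_term_def by (simp only: left_diff_distrib mult.assoc)
  also have "\<bar>\<dots>\<bar> \<le> \<bar>real_of_int m\<bar> * \<bar>?e\<bar> + \<bar>of_int m * \<xi> - of_int n\<bar> * \<bar>?c * ?e\<bar>"
    unfolding abs_mult[symmetric] by (rule abs_triangle_ineq4)
  also have "\<dots> \<le> \<bar>real_of_int m\<bar> * (3/4) ^ i + \<bar>of_int m * \<xi> - of_int n\<bar> * (3/4) ^ i"
  proof (intro add_mono mult_left_mono abs_coefficient_digit_le)
    have "\<bar>?e\<bar> \<le> (1/2) ^ i" by (simp add: field_simps)
    also have "\<dots> \<le> (3/4) ^ i" by (rule power_mono) auto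
    finally show "\<bar>?e\<bar> \<le> (3/4) ^ i" .
  qed auto
  finally show ?thesis by (simp add: comb_size_def algebra_simps)
qed

lemma comb_sums: "(\<lambda>i. comb_term \<xi> m n i \<omega>) sums comb \<xi> m n \<omega>"
proof -
  have "summable (\<lambda>i. (3/4::real) ^ i)" by (simp add: summable_geometric)
  then have "summable (\<lambda>i. coefficient \<xi> i (initial i \<omega>) * (of_bool (\<omega> i) / 2 ^ Suc i))"
    by (rule summable_comparison_test') (use abs_coefficient_digit_le in simp)
  then have b: "(\<lambda>i. coefficient \<xi> i (initial i \<omega>) * (of_bool (\<omega> i) / 2 ^ Suc i)) sums gen_b \<xi> \<omega>"
    unfolding gen_b_def by (rule summable_sums)
  have "summable (\<lambda>i. of_bool (\<omega> i) / 2 ^ Suc i :: real)"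
    by (rule summable_comparison_test'[OF sums_summable[OF power_half_series]]) (auto simp: power_one_over)
  then have v: "(\<lambda>i. of_bool (\<omega> i) / 2 ^ Suc i) sums binary_value \<omega>"
    unfolding binary_value_def by (rule summable_sums)
  have "(\<lambda>i. of_int m * (of_bool (\<omega> i) / 2 ^ Suc i) -
      (of_int m * \<xi> - of_int n) * (coefficient \<xi> i (initial i \<omega>) * (of_bool (\<omega> i) / 2 ^ Suc i)))
    sums (of_int m * binary_value \<omega> - (of_int m * \<xi> - of_int n) * gen_b \<xi> \<omega>)"
    by (intro sums_diff sums_mult b v)
  then show "(\<lambda>i. comb_term \<xi> m n i \<omega>) sums comb \<xi> m n \<omega>"
    by (simp only: comb_term_def comb_def gen_a_def left_diff_distrib mult.assoc)
      (simp add: algebra_simps)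
qed

lemma continuous_on_comb: "continuous_on UNIV (comb \<xi> m n)"
proof -
  have "summable (\<lambda>i. comb_size \<xi> m n * (3/4) ^ i)"
    by (intro summable_mult summable_geometric) simp
  then have "uniform_limit UNIV (\<lambda>N \<omega>. \<Sum>i<N. comb_term \<xi> m n i \<omega>)
      (\<lambda>\<omega>. \<Sum>i. comb_term \<xi> m n i \<omega>) sequentially"
    by (rule Weierstrass_m_test[rotated]) (simp add: abs_comb_term_le)
  moreover have "(\<lambda>\<omega>. \<Sum>i. comb_term \<xi> m n i \<omega>) = comb \<xi> m n"
    using sums_unique[OF comb_sums] by (simp add: fun_eq_iff)
  moreover have "continuous_on UNIV (\<lambda>\<omega>. \<Sum>i<N. comb_term \<xi> m n i \<omega>)" for N
  proof (intro continuous_on_sum)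
    fix i
    define g where "g = (\<lambda>w. (of_int m - (of_int m * \<xi> - of_int n) * coefficient \<xi> i (take i w)) *
      (of_bool (w ! i) / 2 ^ Suc i))"
    have "comb_term \<xi> m n i = (\<lambda>\<omega>. g (initial (Suc i) \<omega>))"
      by (simp add: fun_eq_iff comb_term_def g_def take_initial nth_initial)
    then show "continuous_on UNIV (\<lambda>\<omega>. comb_term \<xi> m n i \<omega>)"
      using continuous_on_initial[of g "Suc i"] by simp
  qed
  ultimately show ?thesis
    by (intro uniform_limit_theorem) (auto intro: always_eventually)
qed

section \<open>The generated group as a countable union of compact sets\<close>

definition cylinder_image :: "real \<Rightarrow> nat \<Rightarrow> bool list \<times> int \<times> int \<Rightarrow> real set"
  where "cylinder_image \<xi> k = (\<lambda>(h, m, n). comb \<xi> m n ` {\<omega>. initial k \<omega> = h})"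

text \<open>One summand is taken for each entry of the list, with the sequence confined to the cylinder that the
  entry names. For a list with distinct keys these are the points for which the pattern \<open>(k, xs)\<close>
  controls all summands at once.\<close>

primrec pattern_sums :: "real \<Rightarrow> nat \<Rightarrow> (bool list \<times> int \<times> int) list \<Rightarrow> real set"
  where "pattern_sums \<xi> k [] = {0}"
  | "pattern_sums \<xi> k (x # xs) = {u + v | u v. u \<in> cylinder_image \<xi> k x \<and> v \<in> pattern_sums \<xi> k xs}"

lemma compact_pattern_sums: "compact (pattern_sums \<xi> k xs)"
proof (induction xs)
  case Nil
  then show ?case by simp
next
  case (Cons x xs)
  have "compact (cylinder_image \<xi> k x)"
    unfolding cylinder_image_def case_prod_beta
    by (intro compact_continuous_image compact_cylinder continuous_on_subset[OF continuous_on_comb]) simp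
  then show ?case using compact_sums[OF _ Cons.IH] by simp
qed

text \<open>The group generated by all \<open>a(\<omega>)\<close> and \<open>b(\<omega>)\<close>. Collecting terms over a finite set of sequences, rather
  than listing summands, ensures that different summands belong to different sequences.\<close>

definition comb_group :: "real \<Rightarrow> real set"
  where "comb_group \<xi> = {\<Sum>\<omega>\<in>S. comb \<xi> (M \<omega>) (N \<omega>) \<omega> | S M N. finite S}"

lemma comb_groupI: "finite S \<Longrightarrow> x = (\<Sum>\<omega>\<in>S. comb \<xi> (M \<omega>) (N \<omega>) \<omega>) \<Longrightarrow> x \<in> comb_group \<xi>"
  unfolding comb_group_def by blast

lemma comb_groupE:
  assumes "x \<in> comb_group \<xi>"
  obtains S M N where "finite S" "x = (\<Sum>\<omega>\<in>S. comb \<xi> (M \<omega>) (N \<omega>) \<omega>)"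
  using assms unfolding comb_group_def by blast

lemma comb_add: "comb \<xi> (m + m') (n + n') \<omega> = comb \<xi> m n \<omega> + comb \<xi> m' n' \<omega>"
  by (simp add: comb_def algebra_simps)

lemma comb_zero [simp]: "comb \<xi> 0 0 \<omega> = 0"
  by (simp add: comb_def)

lemma comb_minus: "comb \<xi> (- m) (- n) \<omega> = - comb \<xi> m n \<omega>"
  by (simp add: comb_def)

lemma comb_in_group: "comb \<xi> m n \<omega> \<in> comb_group \<xi>"
  by (rule comb_groupI[of "{\<omega>}" _ _ "\<lambda>_. m" "\<lambda>_. n"]) auto

lemma comb_group_zero: "0 \<in> comb_group \<xi>"
  by (rule comb_groupI[of "{}"]) auto

lemma comb_group_minus:
  assumes "x \<in> comb_group \<xi>"
  shows "- x \<in> comb_group \<xi>"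
proof -
  obtain S M N where S: "finite S" "x = (\<Sum>\<omega>\<in>S. comb \<xi> (M \<omega>) (N \<omega>) \<omega>)"
    using assms by (rule comb_groupE)
  then show ?thesis
    by (intro comb_groupI[of S _ _ "\<lambda>\<omega>. - M \<omega>" "\<lambda>\<omega>. - N \<omega>"]) (simp_all add: comb_minus sum_negf)
qed

lemma comb_group_add:
  assumes "x \<in> comb_group \<xi>" "y \<in> comb_group \<xi>"
  shows "x + y \<in> comb_group \<xi>"
proof -
  obtain S M N where S: "finite S" "x = (\<Sum>\<omega>\<in>S. comb \<xi> (M \<omega>) (N \<omega>) \<omega>)"
    using assms(1) by (rule comb_groupE)
  obtain S' M' N' where S': "finite S'" "y = (\<Sum>\<omega>\<in>S'. comb \<xi> (M' \<omega>) (N' \<omega>) \<omega>)"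
    using assms(2) by (rule comb_groupE)
  \<comment> \<open>Extending the multiplicities by zero lets both sums range over the same finite set.\<close>
  define z where "z = (\<lambda>T (f :: (nat \<Rightarrow> bool) \<Rightarrow> int) \<omega>. if \<omega> \<in> T then f \<omega> else 0)"
  have ext: "(\<Sum>\<omega>\<in>S \<union> S'. comb \<xi> (z T f \<omega>) (z T g \<omega>) \<omega>) = (\<Sum>\<omega>\<in>T. comb \<xi> (f \<omega>) (g \<omega>) \<omega>)"
    if "T \<subseteq> S \<union> S'" for T f g
    using that S(1) S'(1) by (intro sum.mono_neutral_cong_right) (auto simp: z_def)
  show ?thesis
    by (rule comb_groupI[of "S \<union> S'" _ _ "\<lambda>\<omega>. z S M \<omega> + z S' M' \<omega>" "\<lambda>\<omega>. z S N \<omega> + z S' N' \<omega>"])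
      (use S S' in \<open>simp_all add: comb_add sum.distrib ext\<close>)
qed

lemma pattern_sums_subset_group: "pattern_sums \<xi> k xs \<subseteq> comb_group \<xi>"
proof (induction xs)
  case Nil
  then show ?case by (simp add: comb_group_zero)
next
  case (Cons x xs)
  have "cylinder_image \<xi> k x \<subseteq> comb_group \<xi>"
    by (auto simp: cylinder_image_def comb_in_group split: prod.splits)
  then show ?case using Cons.IH by (auto intro!: comb_group_add)
qed

text \<open>Finitely many distinct sequences are told apart by their first \<open>k\<close> digits for some \<open>k\<close>, so each of them can
  be assigned its own integer combination by a pattern.\<close>

lemma comb_group_in_pattern_sums:
  assumes "x \<in> comb_group \<xi>"
  shows "\<exists>k xs. distinct (map fst xs) \<and> x \<in> pattern_sums \<xi> k xs"
proof -
  obtain S M N where S: "finite S" "x = (\<Sum>\<omega>\<in>S. comb \<xi> (M \<omega>) (N \<omega>) \<omega>)"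
    using assms by (rule comb_groupE)
  obtain k where k: "inj_on (initial k) S" using initial_separates[OF S(1)] by blast
  obtain ws where ws: "set ws = S" "distinct ws" using finite_distinct_list[OF S(1)] by blast
  have "(\<Sum>\<omega>\<leftarrow>vs. comb \<xi> (M \<omega>) (N \<omega>) \<omega>) \<in> pattern_sums \<xi> k (map (\<lambda>\<omega>. (initial k \<omega>, M \<omega>, N \<omega>)) vs)" for vs
  proof (induction vs)
    case Nil
    then show ?case by simp
  next
    case (Cons v vs)
    have "comb \<xi> (M v) (N v) v \<in> cylinder_image \<xi> k (initial k v, M v, N v)"
      by (simp add: cylinder_image_def)
    then show ?case using Cons.IH by auto
  qed
  from this[of ws] have "x \<in> pattern_sums \<xi> k (map (\<lambda>\<omega>. (initial k \<omega>, M \<omega>, N \<omega>)) ws)"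
    using S(2) ws by (simp add: sum_list_distinct_conv_sum_set)
  moreover have "distinct (map fst (map (\<lambda>\<omega>. (initial k \<omega>, M \<omega>, N \<omega>)) ws))"
    using k ws by (simp add: distinct_map comp_def)
  ultimately show ?thesis by blast
qed

lemma comb_group_eq:
  "comb_group \<xi> = (\<Union>p\<in>{p. distinct (map fst (snd p))}. pattern_sums \<xi> (fst p) (snd p))"
  using comb_group_in_pattern_sums pattern_sums_subset_group by fastforce

section \<open>The group is thin at infinitely many scales\<close>

lemma covered_by_sums:
  fixes E F :: "real set"
  assumes "covered_by N r E" "covered_by N' r' F" "0 \<le> r" "0 \<le> r'"
  shows "covered_by (N * N') (r + r') {u + v | u v. u \<in> E \<and> v \<in> F}"
proof -
  obtain \<U> where \<U>: "finite \<U>" "card \<U> \<le> N" "E \<subseteq> \<Union>\<U>" "\<forall>U\<in>\<U>. bounded U \<and> diameter U \<le> r"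
    using assms(1) unfolding covered_by_def by blast
  obtain \<V> where \<V>: "finite \<V>" "card \<V> \<le> N'" "F \<subseteq> \<Union>\<V>" "\<forall>V\<in>\<V>. bounded V \<and> diameter V \<le> r'"
    using assms(2) unfolding covered_by_def by blast
  show ?thesis
  proof (rule covered_by_imageI[where I = "\<U> \<times> \<V>" and U = "\<lambda>(U, V). {u + v | u v. u \<in> U \<and> v \<in> V}"])
    show "card (\<U> \<times> \<V>) \<le> N * N'"
      using \<U>(2) \<V>(2) by (simp add: card_cartesian_product mult_le_mono)
    show "{u + v | u v. u \<in> E \<and> v \<in> F} \<subseteq> (\<Union>i\<in>\<U> \<times> \<V>. case i of (U, V) \<Rightarrow> {u + v | u v. u \<in> U \<and> v \<in> V})"
    proof
      fix x assume "x \<in> {u + v | u v. u \<in> E \<and> v \<in> F}"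
      then obtain u v where x: "x = u + v" "u \<in> E" "v \<in> F" by blast
      then obtain U V where "U \<in> \<U>" "u \<in> U" "V \<in> \<V>" "v \<in> V" using \<U>(3) \<V>(3) by blast
      then show "x \<in> (\<Union>i\<in>\<U> \<times> \<V>. case i of (U, V) \<Rightarrow> {u + v | u v. u \<in> U \<and> v \<in> V})"
        using x(1) by (intro UN_I[of "(U, V)"]) auto
    qed
    fix i x y assume i: "i \<in> \<U> \<times> \<V>"
      and xy: "x \<in> (case i of (U, V) \<Rightarrow> {u + v | u v. u \<in> U \<and> v \<in> V})"
        "y \<in> (case i of (U, V) \<Rightarrow> {u + v | u v. u \<in> U \<and> v \<in> V})"
    obtain U V where UV: "i = (U, V)" "U \<in> \<U>" "V \<in> \<V>" using i by blast
    obtain u v u' v' where uv: "x = u + v" "u \<in> U" "v \<in> V" "y = u' + v'" "u' \<in> U" "v' \<in> V"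
      using xy unfolding UV(1) by auto
    have "dist u u' \<le> diameter U" "dist v v' \<le> diameter V"
      using uv UV(2,3) \<U>(4) \<V>(4) by (auto intro!: diameter_bounded_bound)
    moreover have "diameter U \<le> r" "diameter V \<le> r'" using UV(2,3) \<U>(4) \<V>(4) by auto
    moreover have "dist x y \<le> dist u u' + dist v v'"
      unfolding uv(1,4) by (rule dist_triangle_add)
    ultimately show "dist x y \<le> r + r'" by linarith
  qed (use \<U>(1) \<V>(1) assms(3,4) in auto)
qed

text \<open>Irrationality enters only here, and decisively: \<open>m \<xi> = n\<close> forces \<open>m = n = 0\<close>, when there is nothing to cancel.
  For rational \<open>\<xi>\<close> the combination with \<open>m \<xi> = n\<close> is a multiple of \<open>a + \<xi> b\<close>, whose digits cannot be suppressed.\<close>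

lemma comb_term_eq_0:
  assumes "\<xi> \<notin> \<rat>" "pattern_of_block (block i) = (k, xs)" "k \<le> i"
    and "map_of xs (initial k \<omega>) = Some (m, n)"
    and "\<bar>of_int m / (of_int m * \<xi> - of_int n)\<bar> \<le> (3/2) ^ i"
  shows "comb_term \<xi> m n i \<omega> = 0"
proof -
  have c: "coefficient \<xi> i (initial i \<omega>) = of_int m / (of_int m * \<xi> - of_int n)"
    using assms(2-5) by (simp add: coefficient_def take_initial)
  show ?thesis
  proof (cases "of_int m * \<xi> - of_int n = 0")
    case True
    have "m = 0"
    proof (rule ccontr)
      assume "m \<noteq> 0"
      then have "\<xi> = of_int n / of_int m" using True by (simp add: field_simps)
      then show False using assms(1) by simp
    qed
    then show ?thesis using True by (simp add: comb_term_def)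
  next
    case False
    then show ?thesis by (simp add: comb_term_def c)
  qed
qed

text \<open>Two sequences of the cylinder that agree up to the start of the block also have equal (zero)
  contributions throughout the block, so the values differ only by the tail after the block. The
  factor 8 is a geometric series of sum 4 for each of the two tails.\<close>

lemma abs_comb_diff_le:
  assumes "\<xi> \<notin> \<rat>" "pattern_of_block N = (k, xs)" "k \<le> fact N" "map_of xs h = Some (m, n)"
    and t: "\<bar>of_int m / (of_int m * \<xi> - of_int n)\<bar> \<le> (3/2) ^ N"
    and \<omega>: "initial k \<omega> = h" "initial k \<omega>' = h" "initial (fact N) \<omega> = initial (fact N) \<omega>'"
  shows "\<bar>comb \<xi> m n \<omega> - comb \<xi> m n \<omega>'\<bar> \<le> 8 * comb_size \<xi> m n * (3/4) ^ fact (Suc N)"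
proof -
  define p :: nat where "p = fact (Suc N)"
  define f where "f = (\<lambda>i. comb_term \<xi> m n i \<omega> - comb_term \<xi> m n i \<omega>')"
  have f0: "f i = 0" if "i < p" for i
  proof (cases "i < fact N")
    case True
    have "initial i \<omega> = initial i \<omega>'"
      using \<omega>(3) by (rule initial_eq_mono) (use True in simp)
    moreover have "\<omega> i = \<omega>' i"
      using \<omega>(3) True by (simp add: initial_eq_iff)
    ultimately show ?thesis by (simp add: f_def comb_term_def)
  next
    case False
    then have "block i = N" using that by (intro block_eq) (auto simp: p_def)
    have "N \<le> i" using False fact_ge_self[of N] by linarith
    then have "(3/2::real) ^ N \<le> (3/2) ^ i" by (intro power_increasing) auto
    with t have "\<bar>of_int m / (of_int m * \<xi> - of_int n)\<bar> \<le> (3/2) ^ i" by (rule order_trans)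
    moreover have "k \<le> i" using assms(3) False by linarith
    ultimately have "comb_term \<xi> m n i \<omega> = 0" "comb_term \<xi> m n i \<omega>' = 0"
      using assms(2,4) \<omega>(1,2) \<open>block i = N\<close> by (auto intro!: comb_term_eq_0[OF assms(1)])
    then show ?thesis by (simp add: f_def)
  qed
  have f: "f sums (comb \<xi> m n \<omega> - comb \<xi> m n \<omega>')"
    unfolding f_def by (intro sums_diff comb_sums)
  then have "(\<lambda>i. f (i + p)) sums (comb \<xi> m n \<omega> - comb \<xi> m n \<omega>' - (\<Sum>i<p. f i))"
    by (rule sums_split_initial_segment)
  then have tail: "(\<lambda>i. f (i + p)) sums (comb \<xi> m n \<omega> - comb \<xi> m n \<omega>')"
    using f0 by simp
  define C where "C = 2 * comb_size \<xi> m n * (3/4) ^ p"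
  have g: "(\<lambda>i. C * (3/4) ^ i) sums (C * 4)"
    using sums_mult[OF geometric_sums[of "3/4::real"], of C] by simp
  have le: "norm (f (i + p)) \<le> C * (3/4) ^ i" for i
  proof -
    have "norm (f (i + p)) \<le> \<bar>comb_term \<xi> m n (i + p) \<omega>\<bar> + \<bar>comb_term \<xi> m n (i + p) \<omega>'\<bar>"
      unfolding f_def real_norm_def by (rule abs_triangle_ineq4)
    also have "\<dots> \<le> comb_size \<xi> m n * (3/4) ^ (i + p) + comb_size \<xi> m n * (3/4) ^ (i + p)"
      by (intro add_mono abs_comb_term_le)
    also have "\<dots> = C * (3/4) ^ i" by (simp add: C_def power_add)
    finally show ?thesis .
  qed
  have "norm (\<Sum>i. f (i + p)) \<le> (\<Sum>i. C * (3/4) ^ i)"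
    by (rule norm_suminf_le[OF le sums_summable[OF g]])
  then show ?thesis
    using sums_unique[OF tail] sums_unique[OF g] by (simp add: C_def p_def)
qed

lemma covered_by_cylinder_image:
  assumes "\<xi> \<notin> \<rat>" "pattern_of_block N = (k, xs)" "k \<le> fact N" "map_of xs h = Some (m, n)"
    and "\<bar>of_int m / (of_int m * \<xi> - of_int n)\<bar> \<le> (3/2) ^ N"
  shows "covered_by (2 ^ fact N) (8 * comb_size \<xi> m n * (3/4) ^ fact (Suc N))
           (cylinder_image \<xi> k (h, m, n))"
proof (rule covered_by_imageI[where I = "{w :: bool list. set w \<subseteq> UNIV \<and> length w = fact N}"
      and U = "\<lambda>w. comb \<xi> m n ` {\<omega>. initial k \<omega> = h \<and> initial (fact N) \<omega> = w}"])
  show "card {w :: bool list. set w \<subseteq> UNIV \<and> length w = fact N} \<le> 2 ^ fact N"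
    using card_lists_length_eq[of "UNIV :: bool set" "fact N"] by simp
  show "finite {w :: bool list. set w \<subseteq> UNIV \<and> length w = fact N}"
    by (rule finite_lists_length_eq) simp
  show "cylinder_image \<xi> k (h, m, n) \<subseteq>
    (\<Union>w\<in>{w. set w \<subseteq> UNIV \<and> length w = fact N}. comb \<xi> m n ` {\<omega>. initial k \<omega> = h \<and> initial (fact N) \<omega> = w})"
  proof
    fix x assume "x \<in> cylinder_image \<xi> k (h, m, n)"
    then obtain \<omega> where "x = comb \<xi> m n \<omega>" "initial k \<omega> = h" by (auto simp: cylinder_image_def)
    then show "x \<in> (\<Union>w\<in>{w. set w \<subseteq> UNIV \<and> length w = fact N}. comb \<xi> m n ` {\<omega>. initial k \<omega> = h \<and> initial (fact N) \<omega> = w})"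
      by (intro UN_I[of "initial (fact N) \<omega>"] image_eqI[of _ _ \<omega>]) auto
  qed
  show "0 \<le> 8 * comb_size \<xi> m n * (3/4) ^ fact (Suc N)"
    by (simp add: comb_size_nonneg)
  fix w x y
  assume "x \<in> comb \<xi> m n ` {\<omega>. initial k \<omega> = h \<and> initial (fact N) \<omega> = w}"
    "y \<in> comb \<xi> m n ` {\<omega>. initial k \<omega> = h \<and> initial (fact N) \<omega> = w}"
  then obtain \<omega> \<omega>' where "x = comb \<xi> m n \<omega>" "y = comb \<xi> m n \<omega>'" "initial k \<omega> = h"
    "initial k \<omega>' = h" "initial (fact N) \<omega> = initial (fact N) \<omega>'"
    by auto
  then show "dist x y \<le> 8 * comb_size \<xi> m n * (3/4) ^ fact (Suc N)"
    unfolding dist_real_def using abs_comb_diff_le[OF assms] by simp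
qed

text \<open>The list \<open>ys\<close> is separated from \<open>xs\<close> for the induction: the scale is determined by the blocks of the full
  pattern \<open>(k, xs)\<close>, while the summands are added one at a time.\<close>

lemma covered_by_pattern_sums:
  assumes "\<xi> \<notin> \<rat>" "\<forall>(h, d)\<in>set ys. map_of xs h = Some d"
  shows "\<exists>R>0. \<exists>N0. \<forall>N\<ge>N0. pattern_of_block N = (k, xs) \<longrightarrow>
    covered_by ((2 ^ fact N) ^ length ys) (R * (3/4) ^ fact (Suc N)) (pattern_sums \<xi> k ys)"
  using assms(2)
proof (induction ys)
  case Nil
  have "covered_by 1 r {0 :: real}" if "0 \<le> r" for r
    using that by (intro covered_by_imageI[where I = "{()}" and U = "\<lambda>_. {0}"]) auto
  then show ?case by (intro exI[of _ 1]) auto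
next
  case (Cons y ys)
  obtain h m n where y: "y = (h, m, n)" by (cases y) auto
  obtain R N0 where R: "0 < R" and N0: "\<And>N. N \<ge> N0 \<Longrightarrow> pattern_of_block N = (k, xs) \<Longrightarrow>
    covered_by ((2 ^ fact N) ^ length ys) (R * (3/4) ^ fact (Suc N)) (pattern_sums \<xi> k ys)"
    using Cons by auto
  obtain N1 where N1: "\<bar>of_int m / (of_int m * \<xi> - of_int n)\<bar> < (3/2) ^ N1"
    using real_arch_pow[of "3/2"] by auto
  define R' where "R' = 8 * comb_size \<xi> m n + R"
  have "covered_by ((2 ^ fact N) ^ length (y # ys)) (R' * (3/4) ^ fact (Suc N)) (pattern_sums \<xi> k (y # ys))"
    if N: "N \<ge> max N0 (max N1 k)" and p: "pattern_of_block N = (k, xs)" for N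
  proof -
    have "(3/2::real) ^ N1 \<le> (3/2) ^ N" using N by (intro power_increasing) auto
    then have t: "\<bar>of_int m / (of_int m * \<xi> - of_int n)\<bar> \<le> (3/2) ^ N" using N1 by linarith
    have k: "k \<le> fact N" using N fact_ge_self[of N] by linarith
    have h: "map_of xs h = Some (m, n)" using Cons.prems y by simp
    have "covered_by (2 ^ fact N * (2 ^ fact N) ^ length ys)
        (8 * comb_size \<xi> m n * (3/4) ^ fact (Suc N) + R * (3/4) ^ fact (Suc N))
        {u + v | u v. u \<in> cylinder_image \<xi> k (h, m, n) \<and> v \<in> pattern_sums \<xi> k ys}"
      using R N by (intro covered_by_sums covered_by_cylinder_image[OF assms(1) p k h t] N0[OF _ p])
        (simp_all add: comb_size_nonneg)
    then show ?thesis by (simp only: y R'_def distrib_right length_Cons power_Suc pattern_sums.simps)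
  qed
  moreover have "0 < R'" using R comb_size_nonneg[of \<xi> m n] by (simp add: R'_def)
  ultimately show ?case by blast
qed

text \<open>With \<open>p = N!\<close> and \<open>l\<close> summands there are \<open>2\<^sup>p\<^sup>l\<close> sets of diameter about \<open>(3/4)\<^sup>(\<^sup>N\<^sup>+\<^sup>1\<^sup>)\<^sup>p\<close>, so the \<open>s\<close>-dimensional
  mass is at most a constant times the \<open>p\<close>-th power of \<open>2\<^sup>l ((3/4)\<^sup>s)\<^sup>N\<^sup>+\<^sup>1\<close>. For large \<open>N\<close> that base is below
  one half, whatever \<open>l\<close> and \<open>s > 0\<close> are.\<close>

lemma thinly_covered_pattern_sums:
  assumes "\<xi> \<notin> \<rat>" "distinct (map fst xs)" "0 < s"
  shows "thinly_covered s (pattern_sums \<xi> k xs)"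
  unfolding thinly_covered_def
proof (intro allI impI)
  fix e :: real assume e: "0 < e"
  obtain R N0 where R: "0 < R" and N0: "\<And>N. N \<ge> N0 \<Longrightarrow> pattern_of_block N = (k, xs) \<Longrightarrow>
    covered_by ((2 ^ fact N) ^ length xs) (R * (3/4) ^ fact (Suc N)) (pattern_sums \<xi> k xs)"
    using covered_by_pattern_sums[OF assms(1), of xs xs k] assms(2) by auto
  define q where "q = (3/4::real) powr s"
  have q: "0 < q" "q < 1"
    using assms(3) powr_less_mono2[of s "3/4" 1] by (auto simp: q_def)
  \<comment> \<open>Three requirements that hold for all large \<open>N\<close>; recurrence of patterns then supplies one such \<open>N\<close>.\<close>
  have "(\<lambda>N. 2 ^ length xs * q ^ Suc N) \<longlonglongrightarrow> 2 ^ length xs * 0"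
    using q by (intro tendsto_mult tendsto_const LIMSEQ_Suc LIMSEQ_power_zero) auto
  then have 1: "\<forall>\<^sub>F N in sequentially. 2 ^ length xs * q ^ Suc N < 1/2"
    by (rule order_tendstoD) simp
  have "(\<lambda>N. R powr s * (1/2) ^ N) \<longlonglongrightarrow> R powr s * 0"
    by (intro tendsto_mult tendsto_const LIMSEQ_power_zero) auto
  then have 2: "\<forall>\<^sub>F N in sequentially. R powr s * (1/2) ^ N < e"
    by (rule order_tendstoD) (use e in simp)
  have "(\<lambda>N. R * (3/4) ^ N) \<longlonglongrightarrow> R * 0"
    by (intro tendsto_mult tendsto_const LIMSEQ_power_zero) auto
  then have 3: "\<forall>\<^sub>F N in sequentially. R * (3/4) ^ N < e"
    by (rule order_tendstoD) (use e in simp)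
  from 1 2 3 have "\<forall>\<^sub>F N in sequentially. 2 ^ length xs * q ^ Suc N < 1/2 \<and>
      R powr s * (1/2) ^ N < e \<and> R * (3/4) ^ N < e"
    by eventually_elim simp
  then obtain N1 where N1: "\<And>N. N \<ge> N1 \<Longrightarrow> 2 ^ length xs * q ^ Suc N < 1/2 \<and>
      R powr s * (1/2) ^ N < e \<and> R * (3/4) ^ N < e"
    unfolding eventually_sequentially by blast
  obtain N where N: "N \<ge> max N0 N1" "pattern_of_block N = (k, xs)" using pattern_recurs by blast
  define p :: nat where "p = fact N"
  define r where "r = R * (3/4) ^ fact (Suc N)"
  have pN: "N \<le> p" using fact_ge_self by (simp add: p_def)
  have fS: "fact (Suc N) = Suc N * p" by (simp add: p_def)
  have "r \<le> R * (3/4) ^ N"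
  proof -
    have "N \<le> fact (Suc N)" using fact_ge_self[of "Suc N"] by linarith
    then show ?thesis unfolding r_def using R by (intro mult_left_mono power_decreasing) auto
  qed
  then have "r \<le> e" using N1[of N] N(1) by simp
  moreover have "real ((2 ^ fact N) ^ length xs) * r powr s \<le> e"
  proof -
    have "((3/4) ^ j) powr s = q ^ j" for j
      by (simp add: q_def powr_power powr_powr mult.commute flip: powr_realpow)
    then have "r powr s = R powr s * (q ^ Suc N) ^ p"
      unfolding r_def fS power_mult[symmetric] by (simp only: powr_mult)
    then have "real ((2 ^ fact N) ^ length xs) * r powr s = R powr s * (2 ^ length xs * q ^ Suc N) ^ p"
      by (simp add: p_def power_mult_distrib power_mult[symmetric] mult.commute)
    also have "\<dots> \<le> R powr s * (1/2) ^ p"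
      using N1[of N] N(1) q by (intro mult_left_mono power_mono) auto
    also have "\<dots> \<le> R powr s * (1/2) ^ N"
      using pN by (intro mult_left_mono power_decreasing) auto
    also have "\<dots> \<le> e" using N1[of N] N(1) by simp
    finally show ?thesis .
  qed
  moreover have "covered_by ((2 ^ fact N) ^ length xs) r (pattern_sums \<xi> k xs)"
    unfolding r_def using N by (intro N0) auto
  moreover have "0 < r" using R by (simp add: r_def)
  ultimately show "\<exists>N r. 0 < r \<and> r \<le> e \<and> real N * r powr s \<le> e \<and> covered_by N r (pattern_sums \<xi> k xs)"
    by blast
qed

section \<open>Algebra, topology and dimension of the group\<close>

lemma subgroup_comb_group: "subgroup (comb_group \<xi>) real_add_group"
proof -
  have inv: "m_inv real_add_group x = - x" for x
    unfolding m_inv_def real_add_group_def by (auto intro!: the_equality)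
  show ?thesis
    by (rule subgroup.intro)
      (auto simp: inv, auto simp: real_add_group_def comb_group_add comb_group_zero comb_group_minus)
qed

lemma fsigma_comb_group: "fsigma_in euclidean (comb_group \<xi>)"
  unfolding comb_group_eq
  by (intro fsigma_in_Union) (auto intro!: closed_imp_fsigma_in compact_imp_closed compact_pattern_sums)

text \<open>An integer multiple \<open>K\<close> brings \<open>y\<close> into the range \<open>[0, 1)\<close> of binary values, and \<open>K a\<close>, \<open>K b\<close> stay in the group.\<close>

lemma comb_group_spans: "\<exists>a b. y = a + \<xi> * b \<and> a \<in> comb_group \<xi> \<and> b \<in> comb_group \<xi>"
proof -
  \<comment> \<open>\<open>K\<close> has the sign of \<open>y\<close> (positive for \<open>y = 0\<close>) and strictly larger absolute value.\<close>
  define K :: int where "K = (if y \<ge> 0 then \<lfloor>y\<rfloor> + 1 else \<lfloor>y\<rfloor> - 1)"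
  have "0 \<le> y / K \<and> y / K < 1"
  proof (cases "y \<ge> 0")
    case True
    then have "0 \<le> y" "y < real_of_int K" by (auto simp: K_def)
    then show ?thesis by simp
  next
    case False
    then have "y < 0" "real_of_int K < y" by (auto simp: K_def) linarith
    then show ?thesis by (simp add: divide_less_eq zero_le_divide_iff)
  qed
  then obtain \<omega> where \<omega>: "binary_value \<omega> = y / K" using ex_binary_value_eq by blast
  have "K \<noteq> 0" by (simp add: K_def) linarith
  then have "y = comb \<xi> K 0 \<omega> + \<xi> * comb \<xi> 0 K \<omega>"
    using \<omega> by (simp add: comb_def gen_a_def algebra_simps)
  then show ?thesis using comb_in_group by blast
qed

theorem corollary4p2:
  fixes \<xi> :: real
  assumes "\<xi> \<notin> \<rat>"
  shows "\<exists>A :: real set. subgroup A real_add_group \<and> fsigma_in euclidean A \<and>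
           hausdorff_dim A = 0 \<and> hausdorff_dim (A \<times> A) = 1 \<and>
           {a + \<xi> * b | a b. a \<in> A \<and> b \<in> A} = UNIV"
proof (intro exI conjI)
  let ?A = "comb_group \<xi>"
  let ?I = "{p :: pattern. distinct (map fst (snd p))}"
  let ?E = "\<lambda>p. pattern_sums \<xi> (fst p) (snd p)"
  show "subgroup ?A real_add_group" by (rule subgroup_comb_group)
  show "fsigma_in euclidean ?A" by (rule fsigma_comb_group)
  show span: "{a + \<xi> * b | a b. a \<in> ?A \<and> b \<in> ?A} = UNIV"
    using comb_group_spans[of _ \<xi>] by blast
  have thin: "thinly_covered s (?E i)" if "i \<in> ?I" "0 < s" for s i
    using that thinly_covered_pattern_sums[OF assms] by auto
  have "hausdorff_dim ?A \<le> ennreal 0"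
  proof (rule hausdorff_dim_leI)
    fix s :: real assume "0 < s"
    then show "hausdorff_measure s ?A = 0"
      by (intro hausdorff_measure_countable_Un_thinly_covered[where I = ?I and E = ?E] thin)
        (simp_all add: comb_group_eq)
  qed simp
  then show "hausdorff_dim ?A = 0" by simp
  \<comment> \<open>Only the first factor is covered economically; the second is merely placed in a bounded interval.\<close>
  have "hausdorff_dim (?A \<times> ?A) \<le> ennreal 1"
  proof (rule hausdorff_dim_leI)
    fix s :: real assume s: "1 < s"
    show "hausdorff_measure s (?A \<times> ?A) = 0"
    proof (rule hausdorff_measure_countable_Un_thinly_covered[where I = "?I \<times> (UNIV :: nat set)"
          and E = "\<lambda>(i, M). ?E i \<times> {- real M..real M}"])
      show "thinly_covered s (case j of (i, M) \<Rightarrow> ?E i \<times> {- real M..real M})" if "j \<in> ?I \<times> UNIV" for j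
      proof -
        obtain i M where j: "j = (i, M)" "i \<in> ?I" using \<open>j \<in> ?I \<times> UNIV\<close> by blast
        have "thinly_covered (1 + (s - 1)) (?E i \<times> {- real M..real M})"
          using s by (intro thinly_covered_Times_interval thin[OF j(2)]) auto
        then show ?thesis by (simp add: j(1))
      qed
      show "?A \<times> ?A \<subseteq> (\<Union>j\<in>?I \<times> UNIV. case j of (i, M) \<Rightarrow> ?E i \<times> {- real M..real M})"
      proof
        fix z assume "z \<in> ?A \<times> ?A"
        then obtain x y where z: "z = (x, y)" "x \<in> ?A" by blast
        then obtain i where i: "i \<in> ?I" "x \<in> ?E i" unfolding comb_group_eq by blast
        obtain M where "\<bar>y\<bar> \<le> real M" using real_arch_simple by blast
        then have "y \<in> {- real M..real M}" by auto
        then show "z \<in> (\<Union>j\<in>?I \<times> UNIV. case j of (i, M) \<Rightarrow> ?E i \<times> {- real M..real M})"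
          using i z(1) by (intro UN_I[of "(i, M)"]) auto
      qed
    qed (use s in simp_all)
  qed simp
  moreover have "1 \<le> hausdorff_dim (?A \<times> ?A)"
  proof (rule one_le_hausdorff_dim_of_projection)
    show "{0..1} \<subseteq> (\<lambda>(x, y). x + \<xi> * y) ` (?A \<times> ?A)"
    proof
      fix t :: real
      obtain a b where "t = a + \<xi> * b" "a \<in> ?A" "b \<in> ?A" using comb_group_spans by blast
      then show "t \<in> (\<lambda>(x, y). x + \<xi> * y) ` (?A \<times> ?A)" by (intro image_eqI[of _ _ "(a, b)"]) auto
    qed
  qed
  ultimately show "hausdorff_dim (?A \<times> ?A) = 1" by (intro antisym) simp_all
qed

end
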